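(* Let $(S,T,\sigma)$ be a normal subcrossed module of a crossed module $(A,B,\alpha)$ in $\mathsf{C}$. Let $N$ and $G$ be the internal groupoids in $\mathsf{C}$ corresponding to $(S,T,\sigma)$ and $(A,B,\alpha)$ respectively. Then $N_1$ is an ideal of $G_1$ and $N_0$ is an ideal of $G_0$.
   Context: Groups with operations. $\mathsf{C}$ is a fixed category of groups with operations: its objects are the algebras with a set $\Omega$ of operations satisfying a set $\mathsf{E}$ of identities, where $\mathsf{E}$ includes the group laws and, with $\Omega_i$ the set of $i$-ary operations: (a) $\Omega=\Omega_0\cup\Omega_1\cup\Omega_2$; (b) the group operations $0,-,+$ (written additively, $+$ not necessarily commutative) belong to $\Omega_0,\Omega_1,\Omega_2$ respectively, $\Omega_0=\{0\}$, and with $\Omega_1'=\Omega_1\setminus\{-\}$, $\Omega_2'=\Omega_2\setminus\{+\}$, if $\star\in\Omega_2'$ then the operation $a\star^{\circ}b=b\star a$ is also in $\Omega_2'$; (c) for each $\star\in\Omega_2'$, $\mathsf{E}$ includes $a\star(b+c)=a\star b+a\star c$; (d) for $\omega\in\Omega_1'$, $\star\in\Omega_2'$, $\mathsf{E}$ includes $\omega(a+b)=\omega(a)+\omega(b)$ and $\omega(a)\star b=\omega(a\star b)$. Morphisms are group homomorphisms preserving all operations in $\Omega_1'$ and $\Omega_2'$. A subobject is a subset containing $0$ and closed under all operations. An ideal $N$ of $A$ is a subobject with $(N,+)$ normal in $(A,+)$ and $a\star n\in N$ for all $a\in A$, $n\in N$, $\star\in\Omega_2'$. Derived actions. Derived actions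 of $B$ on $A$ (objects of $\mathsf{C}$) are the maps $b\cdot a=s(b)+a-s(b)$ and $b\star a=s(b)\star a$ ($\star\in\Omega_2'$) obtained from a split extension $0\to A\to E\xrightarrow{p}B\to 0$ in $\mathsf{C}$ ($p$ surjective, $A=\ker p$, $s\colon B\to E$ a morphism with $ps=\mathrm{id}_B$). One writes $a\star b:=b\star^{\circ}a$. The semidirect product $A\rtimes B$ is the set $A\times B$ with $(a',b')+(a,b)=(a'+b'\cdot a,\,b'+b)$, $(a',b')\star(a,b)=(a'\star a+a'\star b+b'\star a,\,b'\star b)$, $\omega(a,b)=(\omega(a),\omega(b))$ for $\omega\in\Omega_1'$; it is an object of $\mathsf{C}$. Crossed modules. A crossed module $(A,B,\alpha)$ in $\mathsf{C}$ consists of objects $A,B$, derived actions of $B$ on $A$, and a morphism $\alpha\colon A\to B$ such that for all $b\in B$, $a,a'\in A$, $\star\in\Omega_2'$: $\alpha(b\cdot a)=b+\alpha(a)-b$; $\alpha(a)\cdot a'=a+a'-a$; $\alpha(a)\star a'=a\star a'$; $\alpha(b\star a)=b\star\alpha(a)$ and $\alpha(a\star b)=\alpha(a)\star b$. A crossed module $(S,T,\sigma)$ is a subcrossed module of $(A,B,\alpha)$ if $S\subseteq A$ and $T\subseteq B$ are subobjects, $\sigma$ is the restriction of $\alpha$, and the actions of $T$ on $S$ are induced by those of $B$ on $A$. It is normal if: $T$ is an ideal of $B$; $b\cdot s\in S$, $(t\cdot a)-a\in S$, $b\star s\in S$, $t\star a\in S$ for all $b\in B,s\in S,t\in T,a\in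 A$, $\star\in\Omega_2'$. Corresponding internal groupoid. An internal groupoid $G$ in $\mathsf{C}$ is a groupoid whose set of objects $G_0$ and set of morphisms $G_1$ are objects of $\mathsf{C}$ and whose source and target maps $d_0,d_1\colon G_1\to G_0$, identity map $\epsilon\colon G_0\to G_1$ and partial composition are morphisms in $\mathsf{C}$. The internal groupoid corresponding to a crossed module $(A,B,\alpha)$ has objects $B$, morphisms $A\rtimes B$, $d_0(a,b)=b$, $d_1(a,b)=\alpha(a)+b$, $\epsilon(b)=(0,b)$, and $(a_1,b_1)\circ(a,b)=(a_1+a,b)$ when $b_1=\alpha(a)+b$. *)

theory Defs
  imports "HOL-Algebra.Coset"
begin

section \<open>Categories of groups with operations\<close>

datatype ('u, 'w) opterm =
    Var nat
  | Zero
  | Neg "('u, 'w) opterm"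
  | Add "('u, 'w) opterm" "('u, 'w) opterm"
  | Unary 'u "('u, 'w) opterm"
  | Binary 'w "('u, 'w) opterm" "('u, 'w) opterm"

text \<open>
  The operation symbols are \<open>0\<close>, \<open>-\<close>, \<open>+\<close> together with \<open>unops = \<Omega>\<^sub>1'\<close> and
  \<open>binops = \<Omega>\<^sub>2'\<close>. The latter are sets of symbols rather than whole types so that they
  may be empty. \<open>opp\<close> sends the symbol of \<open>\<star>\<close> to that of \<open>\<star>\<degree>\<close>.
\<close>

record ('u, 'w) opcat =
  unops :: "'u set"
  binops :: "'w set"
  opp :: "'w \<Rightarrow> 'w"
  idents :: "(('u, 'w) opterm \<times> ('u, 'w) opterm) set"

primrec wf_opterm :: "('u, 'w) opcat \<Rightarrow> ('u, 'w) opterm \<Rightarrow> bool" where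
  "wf_opterm C (Var n) \<longleftrightarrow> True"
| "wf_opterm C Zero \<longleftrightarrow> True"
| "wf_opterm C (Neg t) \<longleftrightarrow> wf_opterm C t"
| "wf_opterm C (Add s t) \<longleftrightarrow> wf_opterm C s \<and> wf_opterm C t"
| "wf_opterm C (Unary \<omega> t) \<longleftrightarrow> \<omega> \<in> unops C \<and> wf_opterm C t"
| "wf_opterm C (Binary w s t) \<longleftrightarrow> w \<in> binops C \<and> wf_opterm C s \<and> wf_opterm C t"

definition group_idents :: "(('u, 'w) opterm \<times> ('u, 'w) opterm) set" where
  "group_idents =
    {(Add (Add (Var 0) (Var 1)) (Var 2), Add (Var 0) (Add (Var 1) (Var 2))),
     (Add Zero (Var 0), Var 0), (Add (Var 0) Zero, Var 0),
     (Add (Neg (Var 0)) (Var 0), Zero), (Add (Var 0) (Neg (Var 0)), Zero)}"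

definition operation_idents ::
    "('u, 'w) opcat \<Rightarrow> (('u, 'w) opterm \<times> ('u, 'w) opterm) set" where
  "operation_idents C =
    (\<Union>w\<in>binops C.
      {(Binary (opp C w) (Var 0) (Var 1), Binary w (Var 1) (Var 0)),
       (Binary w (Var 0) (Add (Var 1) (Var 2)),
        Add (Binary w (Var 0) (Var 1)) (Binary w (Var 0) (Var 2)))}) \<union>
    (\<Union>\<omega>\<in>unops C.
      {(Unary \<omega> (Add (Var 0) (Var 1)), Add (Unary \<omega> (Var 0)) (Unary \<omega> (Var 1)))}) \<union>
    (\<Union>\<omega>\<in>unops C. \<Union>w\<in>binops C.
      {(Binary w (Unary \<omega> (Var 0)) (Var 1), Unary \<omega> (Binary w (Var 0) (Var 1)))})"

definition groups_with_operations :: "('u, 'w) opcat \<Rightarrow> bool" where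
  "groups_with_operations C \<longleftrightarrow>
    opp C ` binops C \<subseteq> binops C \<and>
    (\<forall>(s, t) \<in> idents C. wf_opterm C s \<and> wf_opterm C t) \<and>
    group_idents \<union> operation_idents C \<subseteq> idents C"

record ('a, 'u, 'w) opalg = "'a partial_object" +
  gzero :: 'a
  gneg :: "'a \<Rightarrow> 'a"
  gadd :: "'a \<Rightarrow> 'a \<Rightarrow> 'a"
  unop :: "'u \<Rightarrow> 'a \<Rightarrow> 'a"
  binop :: "'w \<Rightarrow> 'a \<Rightarrow> 'a \<Rightarrow> 'a"

primrec opterm_eval ::
    "('a, 'u, 'w) opalg \<Rightarrow> (nat \<Rightarrow> 'a) \<Rightarrow> ('u, 'w) opterm \<Rightarrow> 'a" where
  "opterm_eval A \<rho> (Var n) = \<rho> n"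
| "opterm_eval A \<rho> Zero = gzero A"
| "opterm_eval A \<rho> (Neg t) = gneg A (opterm_eval A \<rho> t)"
| "opterm_eval A \<rho> (Add s t) = gadd A (opterm_eval A \<rho> s) (opterm_eval A \<rho> t)"
| "opterm_eval A \<rho> (Unary \<omega> t) = unop A \<omega> (opterm_eval A \<rho> t)"
| "opterm_eval A \<rho> (Binary w s t) = binop A w (opterm_eval A \<rho> s) (opterm_eval A \<rho> t)"

definition closed_under_ops :: "('u, 'w) opcat \<Rightarrow> ('a, 'u, 'w) opalg \<Rightarrow> 'a set \<Rightarrow> bool" where
  "closed_under_ops C A U \<longleftrightarrow>
    gzero A \<in> U \<and>
    (\<forall>x\<in>U. gneg A x \<in> U) \<and>
    (\<forall>x\<in>U. \<forall>y\<in>U. gadd A x y \<in> U) \<and>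
    (\<forall>\<omega>\<in>unops C. \<forall>x\<in>U. unop A \<omega> x \<in> U) \<and>
    (\<forall>w\<in>binops C. \<forall>x\<in>U. \<forall>y\<in>U. binop A w x y \<in> U)"

definition opobject :: "('u, 'w) opcat \<Rightarrow> ('a, 'u, 'w) opalg \<Rightarrow> bool" where
  "opobject C A \<longleftrightarrow>
    closed_under_ops C A (carrier A) \<and>
    (\<forall>(s, t) \<in> idents C. \<forall>\<rho>. range \<rho> \<subseteq> carrier A \<longrightarrow> opterm_eval A \<rho> s = opterm_eval A \<rho> t)"

definition add_group :: "('a, 'u, 'w) opalg \<Rightarrow> 'a monoid" where
  "add_group A = \<lparr>carrier = carrier A, mult = gadd A, one = gzero A\<rparr>"

definition opmorphism ::
    "('u, 'w) opcat \<Rightarrow> ('a, 'u, 'w) opalg \<Rightarrow> ('b, 'u, 'w) opalg \<Rightarrow> ('a \<Rightarrow> 'b) \<Rightarrow> bool" where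
  "opmorphism C A B f \<longleftrightarrow>
    f \<in> hom (add_group A) (add_group B) \<and>
    (\<forall>\<omega>\<in>unops C. \<forall>x\<in>carrier A. f (unop A \<omega> x) = unop B \<omega> (f x)) \<and>
    (\<forall>w\<in>binops C. \<forall>x\<in>carrier A. \<forall>y\<in>carrier A. f (binop A w x y) = binop B w (f x) (f y))"

text \<open>
  The operations of an algebra are total on the ambient type and matter only on the carrier,
  so a subobject carries the operations of the ambient object up to equality on its carrier.
\<close>

definition subobject ::
    "('u, 'w) opcat \<Rightarrow> ('a, 'u, 'w) opalg \<Rightarrow> ('a, 'u, 'w) opalg \<Rightarrow> bool" where
  "subobject C S A \<longleftrightarrow>
    opobject C A \<and> carrier S \<subseteq> carrier A \<and> closed_under_ops C A (carrier S) \<and>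
    gzero S = gzero A \<and>
    (\<forall>x\<in>carrier S. gneg S x = gneg A x) \<and>
    (\<forall>x\<in>carrier S. \<forall>y\<in>carrier S. gadd S x y = gadd A x y) \<and>
    (\<forall>\<omega>\<in>unops C. \<forall>x\<in>carrier S. unop S \<omega> x = unop A \<omega> x) \<and>
    (\<forall>w\<in>binops C. \<forall>x\<in>carrier S. \<forall>y\<in>carrier S. binop S w x y = binop A w x y)"

definition opideal ::
    "('u, 'w) opcat \<Rightarrow> ('a, 'u, 'w) opalg \<Rightarrow> ('a, 'u, 'w) opalg \<Rightarrow> bool" where
  "opideal C N A \<longleftrightarrow>
    subobject C N A \<and> carrier N \<lhd> add_group A \<and>
    (\<forall>w\<in>binops C. \<forall>a\<in>carrier A. \<forall>n\<in>carrier N. binop A w a n \<in> carrier N)"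


section \<open>Derived actions and semidirect products\<close>

definition split_extension ::
    "('u, 'w) opcat \<Rightarrow> ('a, 'u, 'w) opalg \<Rightarrow> ('e, 'u, 'w) opalg \<Rightarrow> ('b, 'u, 'w) opalg \<Rightarrow>
     ('a \<Rightarrow> 'e) \<Rightarrow> ('e \<Rightarrow> 'b) \<Rightarrow> ('b \<Rightarrow> 'e) \<Rightarrow> bool" where
  "split_extension C A E B i p s \<longleftrightarrow>
    opobject C A \<and> opobject C E \<and> opobject C B \<and>
    opmorphism C A E i \<and> opmorphism C E B p \<and> opmorphism C B E s \<and>
    inj_on i (carrier A) \<and> i ` carrier A = {e \<in> carrier E. p e = gzero B} \<and>
    p ` carrier E = carrier B \<and> (\<forall>b\<in>carrier B. p (s b) = b)"

text \<open>
  \<open>dot b a\<close> is \<open>b \<cdot> a\<close> and \<open>star w b a\<close> is \<open>b \<star> a\<close>; the right-hand action \<open>a \<star> b\<close> is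
  \<open>star (opp C w) b a\<close>.
\<close>

record ('a, 'b, 'w) opaction =
  dot :: "'b \<Rightarrow> 'a \<Rightarrow> 'a"
  star :: "'w \<Rightarrow> 'b \<Rightarrow> 'a \<Rightarrow> 'a"

definition action_from ::
    "('u, 'w) opcat \<Rightarrow> ('a, 'u, 'w) opalg \<Rightarrow> ('e, 'u, 'w) opalg \<Rightarrow> ('b, 'u, 'w) opalg \<Rightarrow>
     ('a \<Rightarrow> 'e) \<Rightarrow> ('b \<Rightarrow> 'e) \<Rightarrow> ('a, 'b, 'w) opaction \<Rightarrow> bool" where
  "action_from C A E B i s act \<longleftrightarrow>
    (\<forall>b\<in>carrier B. \<forall>a\<in>carrier A.
      dot act b a \<in> carrier A \<and>
      i (dot act b a) = gadd E (gadd E (s b) (i a)) (gneg E (s b))) \<and>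
    (\<forall>w\<in>binops C. \<forall>b\<in>carrier B. \<forall>a\<in>carrier A.
      star act w b a \<in> carrier A \<and> i (star act w b a) = binop E w (s b) (i a))"

text \<open>
  The middle object of the extension is taken on the type \<open>'a \<times> 'b\<close>. This loses no generality:
  see \<open>derived_actionI\<close> below, where it lives on an arbitrary type.
\<close>

definition derived_action ::
    "('u, 'w) opcat \<Rightarrow> ('b, 'u, 'w) opalg \<Rightarrow> ('a, 'u, 'w) opalg \<Rightarrow> ('a, 'b, 'w) opaction \<Rightarrow> bool"
  where
  "derived_action C B A act \<longleftrightarrow>
    (\<exists>(E :: ('a \<times> 'b, 'u, 'w) opalg) i p s.
      split_extension C A E B i p s \<and> action_from C A E B i s act)"

text \<open>The negation is the one forced by the addition.\<close>

definition semidirect ::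
    "('u, 'w) opcat \<Rightarrow> ('a, 'u, 'w) opalg \<Rightarrow> ('b, 'u, 'w) opalg \<Rightarrow> ('a, 'b, 'w) opaction \<Rightarrow>
     ('a \<times> 'b, 'u, 'w) opalg" where
  "semidirect C A B act =
    \<lparr>carrier = carrier A \<times> carrier B,
     gzero = (gzero A, gzero B),
     gneg = (\<lambda>(a, b). (dot act (gneg B b) (gneg A a), gneg B b)),
     gadd = (\<lambda>(a', b') (a, b). (gadd A a' (dot act b' a), gadd B b' b)),
     unop = (\<lambda>\<omega> (a, b). (unop A \<omega> a, unop B \<omega> b)),
     binop = (\<lambda>w (a', b') (a, b).
       (gadd A (gadd A (binop A w a' a) (star act (opp C w) b a')) (star act w b' a),
        binop B w b' b))\<rparr>"


section \<open>Consequences of the identities\<close>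

locale op_object =
  fixes C :: "('u, 'w) opcat" and A :: "('a, 'u, 'w) opalg"
  assumes gwo: "groups_with_operations C" and obj: "opobject C A"
begin

lemma zero_closed [simp]: "gzero A \<in> carrier A"
  and neg_closed [simp]: "x \<in> carrier A \<Longrightarrow> gneg A x \<in> carrier A"
  and add_closed [simp]: "x \<in> carrier A \<Longrightarrow> y \<in> carrier A \<Longrightarrow> gadd A x y \<in> carrier A"
  and unop_closed [simp]: "\<omega> \<in> unops C \<Longrightarrow> x \<in> carrier A \<Longrightarrow> unop A \<omega> x \<in> carrier A"
  and binop_closed [simp]:
    "w \<in> binops C \<Longrightarrow> x \<in> carrier A \<Longrightarrow> y \<in> carrier A \<Longrightarrow> binop A w x y \<in> carrier A"
  using obj by (auto simp: opobject_def closed_under_ops_def)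

lemma opp_closed [simp]: "w \<in> binops C \<Longrightarrow> opp C w \<in> binops C"
  using gwo by (auto simp: groups_with_operations_def)

lemma ident_eq:
  assumes "(s, t) \<in> group_idents \<union> operation_idents C"
    and "x \<in> carrier A" "y \<in> carrier A" "z \<in> carrier A"
  shows "opterm_eval A (\<lambda>n. if n = 0 then x else if n = 1 then y else z) s =
         opterm_eval A (\<lambda>n. if n = 0 then x else if n = 1 then y else z) t"
proof -
  have "(s, t) \<in> idents C"
    using gwo assms(1) by (auto simp: groups_with_operations_def)
  moreover have "range (\<lambda>n::nat. if n = 0 then x else if n = 1 then y else z) \<subseteq> carrier A"
    using assms by auto
  ultimately show ?thesis
    using obj unfolding opobject_def by blast
qed

lemma add_assoc [simp]:
  "x \<in> carrier A \<Longrightarrow> y \<in> carrier A \<Longrightarrow> z \<in> carrier A \<Longrightarrow>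
    gadd A (gadd A x y) z = gadd A x (gadd A y z)"
  using ident_eq[of "Add (Add (Var 0) (Var 1)) (Var 2)" "Add (Var 0) (Add (Var 1) (Var 2))" x y z]
  by (simp add: group_idents_def)

lemma zero_add [simp]: "x \<in> carrier A \<Longrightarrow> gadd A (gzero A) x = x"
  using ident_eq[of "Add Zero (Var 0)" "Var 0" x x x] by (simp add: group_idents_def)

lemma add_zero [simp]: "x \<in> carrier A \<Longrightarrow> gadd A x (gzero A) = x"
  using ident_eq[of "Add (Var 0) Zero" "Var 0" x x x] by (simp add: group_idents_def)

lemma neg_add_self [simp]: "x \<in> carrier A \<Longrightarrow> gadd A (gneg A x) x = gzero A"
  using ident_eq[of "Add (Neg (Var 0)) (Var 0)" Zero x x x] by (simp add: group_idents_def)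

lemma add_neg_self [simp]: "x \<in> carrier A \<Longrightarrow> gadd A x (gneg A x) = gzero A"
  using ident_eq[of "Add (Var 0) (Neg (Var 0))" Zero x x x] by (simp add: group_idents_def)

lemma binop_opp:
  assumes "w \<in> binops C" "x \<in> carrier A" "y \<in> carrier A"
  shows "binop A (opp C w) x y = binop A w y x"
  using ident_eq[of "Binary (opp C w) (Var 0) (Var 1)" "Binary w (Var 1) (Var 0)" x y y] assms
  by (auto simp: operation_idents_def)

lemma binop_add_right:
  assumes "w \<in> binops C" "x \<in> carrier A" "y \<in> carrier A" "z \<in> carrier A"
  shows "binop A w x (gadd A y z) = gadd A (binop A w x y) (binop A w x z)"
  using ident_eq[of "Binary w (Var 0) (Add (Var 1) (Var 2))"
      "Add (Binary w (Var 0) (Var 1)) (Binary w (Var 0) (Var 2))" x y z] assms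
  by (auto simp: operation_idents_def)

lemma binop_add_left:
  assumes "w \<in> binops C" "x \<in> carrier A" "y \<in> carrier A" "z \<in> carrier A"
  shows "binop A w (gadd A x y) z = gadd A (binop A w x z) (binop A w y z)"
  using assms binop_add_right[of "opp C w" z x y] by (simp add: binop_opp)

lemma unop_add:
  assumes "\<omega> \<in> unops C" "x \<in> carrier A" "y \<in> carrier A"
  shows "unop A \<omega> (gadd A x y) = gadd A (unop A \<omega> x) (unop A \<omega> y)"
  using ident_eq[of "Unary \<omega> (Add (Var 0) (Var 1))"
      "Add (Unary \<omega> (Var 0)) (Unary \<omega> (Var 1))" x y y] assms
  by (auto simp: operation_idents_def)

lemma neg_add_cancel [simp]:
  "x \<in> carrier A \<Longrightarrow> y \<in> carrier A \<Longrightarrow> gadd A (gneg A x) (gadd A x y) = y"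
  using add_assoc[of "gneg A x" x y] by simp

lemma add_neg_cancel [simp]:
  "x \<in> carrier A \<Longrightarrow> y \<in> carrier A \<Longrightarrow> gadd A x (gadd A (gneg A x) y) = y"
  using add_assoc[of x "gneg A x" y] by simp

lemma add_left_cancel:
  assumes "x \<in> carrier A" "y \<in> carrier A" "z \<in> carrier A" "gadd A x y = gadd A x z"
  shows "y = z"
  using assms neg_add_cancel by metis

lemma add_right_cancel:
  assumes "x \<in> carrier A" "y \<in> carrier A" "z \<in> carrier A" "gadd A y x = gadd A z x"
  shows "y = z"
proof -
  have "gadd A (gadd A y x) (gneg A x) = gadd A (gadd A z x) (gneg A x)"
    using assms(4) by simp
  then show ?thesis using assms(1-3) by simp
qed

lemma neg_unique:
  assumes "x \<in> carrier A" "y \<in> carrier A" "gadd A y x = gzero A"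
  shows "y = gneg A x"
  using assms add_right_cancel[of x y "gneg A x"] by simp

lemma neg_neg [simp]: "x \<in> carrier A \<Longrightarrow> gneg A (gneg A x) = x"
  using neg_unique[of "gneg A x" x] by simp

lemma neg_zero [simp]: "gneg A (gzero A) = gzero A"
  using neg_unique[of "gzero A" "gzero A"] by simp

lemma neg_add [simp]:
  "x \<in> carrier A \<Longrightarrow> y \<in> carrier A \<Longrightarrow> gneg A (gadd A x y) = gadd A (gneg A y) (gneg A x)"
  using neg_unique[of "gadd A x y" "gadd A (gneg A y) (gneg A x)"] by simp

lemma idem_zero:
  assumes "x \<in> carrier A" "gadd A x x = x"
  shows "x = gzero A"
  using assms add_left_cancel[of x x "gzero A"] by simp

lemma unop_zero [simp]: "\<omega> \<in> unops C \<Longrightarrow> unop A \<omega> (gzero A) = gzero A"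
  using unop_add[of \<omega> "gzero A" "gzero A"] by (intro idem_zero) simp_all

lemma binop_zero_right [simp]:
  "w \<in> binops C \<Longrightarrow> x \<in> carrier A \<Longrightarrow> binop A w x (gzero A) = gzero A"
  using binop_add_right[of w x "gzero A" "gzero A"] by (intro idem_zero) simp_all

lemma binop_zero_left [simp]:
  "w \<in> binops C \<Longrightarrow> x \<in> carrier A \<Longrightarrow> binop A w (gzero A) x = gzero A"
  using binop_add_left[of w "gzero A" "gzero A" x] by (intro idem_zero) simp_all

text \<open>Expanding \<open>(x + y) \<star> (z + u)\<close> in both orders shows that products commute.\<close>

lemma binop_commute:
  assumes w: "w \<in> binops C"
    and c: "x \<in> carrier A" "y \<in> carrier A" "z \<in> carrier A" "u \<in> carrier A"
  shows "gadd A (binop A w x z) (binop A w y u) = gadd A (binop A w y u) (binop A w x z)"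
proof -
  let ?p = "binop A w"
  have "gadd A (?p y z) (gadd A (?p y u) (gadd A (?p x z) (?p x u))) =
        gadd A (?p y z) (gadd A (?p x z) (gadd A (?p y u) (?p x u)))"
    using binop_add_left[OF w c(2,1), of "gadd A z u"] binop_add_right[OF w _ c(3,4), of "gadd A y x"]
    using w c by (simp add: binop_add_left binop_add_right)
  then have "gadd A (?p y u) (gadd A (?p x z) (?p x u)) =
        gadd A (?p x z) (gadd A (?p y u) (?p x u))"
    using w c by (auto dest!: add_left_cancel[rotated 3])
  then have "gadd A (gadd A (?p y u) (?p x z)) (?p x u) =
        gadd A (gadd A (?p x z) (?p y u)) (?p x u)"
    using w c by simp
  then show ?thesis
    using w c add_right_cancel[of "?p x u" "gadd A (?p y u) (?p x z)" "gadd A (?p x z) (?p y u)"]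
    by simp
qed

lemma binop_left_commute:
  assumes "w \<in> binops C"
    and "x \<in> carrier A" "y \<in> carrier A" "z \<in> carrier A" "u \<in> carrier A" "v \<in> carrier A"
  shows "gadd A (binop A w x z) (gadd A (binop A w y u) v) =
    gadd A (binop A w y u) (gadd A (binop A w x z) v)"
  using assms binop_commute[of w x y z u] by (simp flip: add_assoc)

lemmas binop_AC = binop_commute binop_left_commute

lemma group_add_group: "group (add_group A)"
proof (rule groupI)
  fix x assume "x \<in> carrier (add_group A)"
  then have "gneg A x \<in> carrier (add_group A)"
    "gneg A x \<otimes>\<^bsub>add_group A\<^esub> x = \<one>\<^bsub>add_group A\<^esub>"
    by (simp_all add: add_group_def)
  then show "\<exists>y\<in>carrier (add_group A). y \<otimes>\<^bsub>add_group A\<^esub> x = \<one>\<^bsub>add_group A\<^esub>"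
    by blast
qed (simp_all add: add_group_def)

end

locale op_morphism = A: op_object C A + B: op_object C B
  for C :: "('u, 'w) opcat" and A :: "('a, 'u, 'w) opalg" and B :: "('b, 'u, 'w) opalg" +
  fixes f :: "'a \<Rightarrow> 'b"
  assumes mor: "opmorphism C A B f"
begin

lemma closed [simp]: "x \<in> carrier A \<Longrightarrow> f x \<in> carrier B"
  and map_add [simp]:
    "x \<in> carrier A \<Longrightarrow> y \<in> carrier A \<Longrightarrow> f (gadd A x y) = gadd B (f x) (f y)"
  and map_unop [simp]:
    "\<omega> \<in> unops C \<Longrightarrow> x \<in> carrier A \<Longrightarrow> f (unop A \<omega> x) = unop B \<omega> (f x)"
  and map_binop [simp]:
    "w \<in> binops C \<Longrightarrow> x \<in> carrier A \<Longrightarrow> y \<in> carrier A \<Longrightarrow>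
      f (binop A w x y) = binop B w (f x) (f y)"
  using mor by (auto simp: opmorphism_def hom_def add_group_def)

lemma map_zero [simp]: "f (gzero A) = gzero B"
  using map_add[of "gzero A" "gzero A"] by (intro B.idem_zero) simp_all

lemma map_neg [simp]: "x \<in> carrier A \<Longrightarrow> f (gneg A x) = gneg B (f x)"
  using map_add[of "gneg A x" x] by (intro B.neg_unique) simp_all

end

text \<open>An algebra that embeds into an object satisfies all of its identities.\<close>

lemma opobject_embed:
  assumes gwo: "groups_with_operations C" and E: "opobject C E"
    and cl: "closed_under_ops C A (carrier A)"
    and f: "f ` carrier A \<subseteq> carrier E" "inj_on f (carrier A)"
    and zero: "f (gzero A) = gzero E"
    and neg: "\<And>x. x \<in> carrier A \<Longrightarrow> f (gneg A x) = gneg E (f x)"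
    and add: "\<And>x y. x \<in> carrier A \<Longrightarrow> y \<in> carrier A \<Longrightarrow> f (gadd A x y) = gadd E (f x) (f y)"
    and un: "\<And>\<omega> x. \<omega> \<in> unops C \<Longrightarrow> x \<in> carrier A \<Longrightarrow> f (unop A \<omega> x) = unop E \<omega> (f x)"
    and bin: "\<And>w x y. w \<in> binops C \<Longrightarrow> x \<in> carrier A \<Longrightarrow> y \<in> carrier A \<Longrightarrow>
      f (binop A w x y) = binop E w (f x) (f y)"
  shows "opobject C A"
proof -
  have ev: "opterm_eval A \<rho> t \<in> carrier A \<and> f (opterm_eval A \<rho> t) = opterm_eval E (f \<circ> \<rho>) t"
    if "range \<rho> \<subseteq> carrier A" "wf_opterm C t" for \<rho> t
    using that(2) that(1) cl
    by (induction t) (auto simp: closed_under_ops_def zero neg add un bin)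
  have "opterm_eval A \<rho> s = opterm_eval A \<rho> t"
    if st: "(s, t) \<in> idents C" and \<rho>: "range \<rho> \<subseteq> carrier A" for s t \<rho>
  proof -
    have wf: "wf_opterm C s" "wf_opterm C t"
      using gwo st by (auto simp: groups_with_operations_def)
    have "range (f \<circ> \<rho>) \<subseteq> carrier E"
      using f(1) \<rho> by auto
    then have "opterm_eval E (f \<circ> \<rho>) s = opterm_eval E (f \<circ> \<rho>) t"
      using E st unfolding opobject_def by blast
    then show ?thesis
      using ev[OF \<rho> wf(1)] ev[OF \<rho> wf(2)] inj_onD[OF f(2)] by simp
  qed
  then show ?thesis
    using cl by (auto simp: opobject_def)
qed


section \<open>The semidirect product is an object\<close>

lemma semidirect_simps [simp]:
  "carrier (semidirect C A B act) = carrier A \<times> carrier B"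
  "gzero (semidirect C A B act) = (gzero A, gzero B)"
  "gneg (semidirect C A B act) (a, b) = (dot act (gneg B b) (gneg A a), gneg B b)"
  "gadd (semidirect C A B act) (a', b') (a, b) = (gadd A a' (dot act b' a), gadd B b' b)"
  "unop (semidirect C A B act) \<omega> (a, b) = (unop A \<omega> a, unop B \<omega> b)"
  "binop (semidirect C A B act) w (a', b') (a, b) =
    (gadd A (gadd A (binop A w a' a) (star act (opp C w) b a')) (star act w b' a),
     binop B w b' b)"
  by (simp_all add: semidirect_def)

locale split_ext =
  i: op_morphism C A E i + p: op_morphism C E B p + s: op_morphism C B E s
  for C :: "('u, 'w) opcat" and A :: "('a, 'u, 'w) opalg" and E :: "('e, 'u, 'w) opalg"
    and B :: "('b, 'u, 'w) opalg"
    and i :: "'a \<Rightarrow> 'e" and p :: "'e \<Rightarrow> 'b" and s :: "'b \<Rightarrow> 'e" +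
  fixes act :: "('a, 'b, 'w) opaction"
  assumes split: "split_extension C A E B i p s" and act: "action_from C A E B i s act"
begin

lemma dot_closed [simp]: "b \<in> carrier B \<Longrightarrow> a \<in> carrier A \<Longrightarrow> dot act b a \<in> carrier A"
  and i_dot [simp]: "b \<in> carrier B \<Longrightarrow> a \<in> carrier A \<Longrightarrow>
    i (dot act b a) = gadd E (gadd E (s b) (i a)) (gneg E (s b))"
  and star_closed [simp]: "w \<in> binops C \<Longrightarrow> b \<in> carrier B \<Longrightarrow> a \<in> carrier A \<Longrightarrow>
    star act w b a \<in> carrier A"
  and i_star [simp]: "w \<in> binops C \<Longrightarrow> b \<in> carrier B \<Longrightarrow> a \<in> carrier A \<Longrightarrow>
    i (star act w b a) = binop E w (s b) (i a)"
  using act by (auto simp: action_from_def)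

lemma p_s [simp]: "b \<in> carrier B \<Longrightarrow> p (s b) = b"
  and p_i [simp]: "a \<in> carrier A \<Longrightarrow> p (i a) = gzero B"
  and inj_i: "inj_on i (carrier A)"
  using split by (auto simp: split_extension_def)

abbreviation "P \<equiv> semidirect C A B act"

definition emb :: "'a \<times> 'b \<Rightarrow> 'e" where
  "emb = (\<lambda>(a, b). gadd E (i a) (s b))"

lemma inj_emb: "inj_on emb (carrier P)"
proof (rule inj_onI, clarsimp)
  fix a b a' b'
  assume *: "emb (a, b) = emb (a', b')" "a \<in> carrier A" "b \<in> carrier B"
    "a' \<in> carrier A" "b' \<in> carrier B"
  have "p (emb (a, b)) = p (emb (a', b'))" using * by simp
  then have b: "b = b'" using * by (simp add: emb_def)
  then have "i a = i a'"
    using * i.B.add_right_cancel[of "s b'" "i a" "i a'"] by (simp add: emb_def)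
  then show "a = a' \<and> b = b'"
    using b * inj_i by (auto dest: inj_onD)
qed

lemma emb_closed: "emb ` carrier P \<subseteq> carrier E"
  by (auto simp: emb_def)

lemma emb_zero: "emb (gzero P) = gzero E"
  and emb_neg: "x \<in> carrier P \<Longrightarrow> emb (gneg P x) = gneg E (emb x)"
  and emb_add: "x \<in> carrier P \<Longrightarrow> y \<in> carrier P \<Longrightarrow> emb (gadd P x y) = gadd E (emb x) (emb y)"
  and emb_unop: "\<omega> \<in> unops C \<Longrightarrow> x \<in> carrier P \<Longrightarrow> emb (unop P \<omega> x) = unop E \<omega> (emb x)"
  by (auto simp: emb_def i.B.unop_add)

lemma emb_binop:
  assumes "w \<in> binops C" "x \<in> carrier P" "y \<in> carrier P"
  shows "emb (binop P w x y) = binop E w (emb x) (emb y)"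
proof -
  obtain a b c d where xy: "x = (a, b)" "y = (c, d)"
    and c: "a \<in> carrier A" "b \<in> carrier B" "c \<in> carrier A" "d \<in> carrier B"
    using assms by auto
  show ?thesis
    using assms(1) c i.B.binop_commute[OF assms(1), of "i a" "s b" "s d" "i c"]
    by (simp add: xy emb_def i.B.binop_add_left i.B.binop_add_right i.B.binop_opp
        flip: i.B.add_assoc)
qed

lemma opobject_semidirect: "opobject C P"
  by (rule opobject_embed[where f = emb and E = E])
    (use inj_emb emb_closed emb_zero emb_neg emb_add emb_unop emb_binop i.A.gwo i.B.obj in
      \<open>auto simp: closed_under_ops_def\<close>)

lemma emb_eqD: "emb x = emb y \<Longrightarrow> x \<in> carrier P \<Longrightarrow> y \<in> carrier P \<Longrightarrow> x = y"
  using inj_emb by (auto dest: inj_onD)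

lemma dot_zero_left [simp]: "a \<in> carrier A \<Longrightarrow> dot act (gzero B) a = a"
  and dot_zero_right [simp]: "b \<in> carrier B \<Longrightarrow> dot act b (gzero A) = gzero A"
  and star_zero_left [simp]: "w \<in> binops C \<Longrightarrow> a \<in> carrier A \<Longrightarrow> star act w (gzero B) a = gzero A"
  and star_zero_right [simp]:
    "w \<in> binops C \<Longrightarrow> b \<in> carrier B \<Longrightarrow> star act w b (gzero A) = gzero A"
  by (rule inj_onD[OF inj_i]; simp)+

lemma split_semidirect:
  "split_extension C A P B (\<lambda>a. (a, gzero B)) snd (\<lambda>b. (gzero A, b))"
  unfolding split_extension_def
proof (intro conjI)
  show "opmorphism C A P (\<lambda>a. (a, gzero B))"
    by (auto simp: opmorphism_def hom_def add_group_def)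
  show "opmorphism C P B snd"
    by (auto simp: opmorphism_def hom_def add_group_def)
  show "opmorphism C B P (\<lambda>b. (gzero A, b))"
    by (auto simp: opmorphism_def hom_def add_group_def)
  have "carrier A \<noteq> {}"
    using i.A.zero_closed by blast
  then show "snd ` carrier P = carrier B"
    by simp
qed (use opobject_semidirect i.A.obj p.B.obj in \<open>auto intro: inj_onI\<close>)

lemma action_semidirect:
  "action_from C A P B (\<lambda>a. (a, gzero B)) (\<lambda>b. (gzero A, b)) act"
  by (auto simp: action_from_def)

end

lemma split_extI:
  assumes "groups_with_operations C" "split_extension C A E B i p s" "action_from C A E B i s act"
  shows "split_ext C A E B i p s act"
  using assms
  by (auto simp: split_ext_def split_ext_axioms_def op_morphism_def op_morphism_axioms_def
      op_object_def split_extension_def)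

lemma derived_actionI:
  fixes E :: "('e, 'u, 'w) opalg"
  assumes "groups_with_operations C" "split_extension C A E B i p s" "action_from C A E B i s act"
  shows "derived_action C B A act"
proof -
  interpret split_ext C A E B i p s act
    using assms by (rule split_extI)
  show ?thesis
    unfolding derived_action_def using split_semidirect action_semidirect by blast
qed

lemma derived_action_split_ext:
  assumes "groups_with_operations C" "derived_action C B A act"
  obtains E :: "('a \<times> 'b, 'u, 'w) opalg" and i p s
  where "split_ext C (A :: ('a, 'u, 'w) opalg) E (B :: ('b, 'u, 'w) opalg) i p s act"
  using assms split_extI unfolding derived_action_def by metis

lemma semidirect_opobject:
  assumes "groups_with_operations C" "derived_action C B A act"
  shows "opobject C (semidirect C A B act)"
  using assms by (elim derived_action_split_ext) (auto intro: split_ext.opobject_semidirect)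


section \<open>Crossed modules\<close>

definition crossed_module ::
    "('u, 'w) opcat \<Rightarrow> ('a, 'u, 'w) opalg \<Rightarrow> ('b, 'u, 'w) opalg \<Rightarrow> ('a, 'b, 'w) opaction \<Rightarrow>
     ('a \<Rightarrow> 'b) \<Rightarrow> bool" where
  "crossed_module C A B act \<alpha> \<longleftrightarrow>
    opobject C A \<and> opobject C B \<and> derived_action C B A act \<and> opmorphism C A B \<alpha> \<and>
    (\<forall>b\<in>carrier B. \<forall>a\<in>carrier A.
      \<alpha> (dot act b a) = gadd B (gadd B b (\<alpha> a)) (gneg B b)) \<and>
    (\<forall>a\<in>carrier A. \<forall>a'\<in>carrier A.
      dot act (\<alpha> a) a' = gadd A (gadd A a a') (gneg A a)) \<and>
    (\<forall>w\<in>binops C. \<forall>a\<in>carrier A. \<forall>a'\<in>carrier A.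
      star act w (\<alpha> a) a' = binop A w a a') \<and>
    (\<forall>w\<in>binops C. \<forall>b\<in>carrier B. \<forall>a\<in>carrier A.
      \<alpha> (star act w b a) = binop B w b (\<alpha> a) \<and>
      \<alpha> (star act (opp C w) b a) = binop B w (\<alpha> a) b)"

definition subcrossed_module ::
    "('u, 'w) opcat \<Rightarrow>
     ('a, 'u, 'w) opalg \<Rightarrow> ('b, 'u, 'w) opalg \<Rightarrow> ('a, 'b, 'w) opaction \<Rightarrow> ('a \<Rightarrow> 'b) \<Rightarrow>
     ('a, 'u, 'w) opalg \<Rightarrow> ('b, 'u, 'w) opalg \<Rightarrow> ('a, 'b, 'w) opaction \<Rightarrow> ('a \<Rightarrow> 'b) \<Rightarrow> bool" where
  "subcrossed_module C S T sact \<sigma> A B act \<alpha> \<longleftrightarrow>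
    crossed_module C S T sact \<sigma> \<and> crossed_module C A B act \<alpha> \<and>
    subobject C S A \<and> subobject C T B \<and>
    (\<forall>s\<in>carrier S. \<sigma> s = \<alpha> s) \<and>
    (\<forall>t\<in>carrier T. \<forall>s\<in>carrier S. dot sact t s = dot act t s) \<and>
    (\<forall>w\<in>binops C. \<forall>t\<in>carrier T. \<forall>s\<in>carrier S. star sact w t s = star act w t s)"

definition normal_subcrossed_module ::
    "('u, 'w) opcat \<Rightarrow>
     ('a, 'u, 'w) opalg \<Rightarrow> ('b, 'u, 'w) opalg \<Rightarrow> ('a, 'b, 'w) opaction \<Rightarrow> ('a \<Rightarrow> 'b) \<Rightarrow>
     ('a, 'u, 'w) opalg \<Rightarrow> ('b, 'u, 'w) opalg \<Rightarrow> ('a, 'b, 'w) opaction \<Rightarrow> ('a \<Rightarrow> 'b) \<Rightarrow> bool" where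
  "normal_subcrossed_module C S T sact \<sigma> A B act \<alpha> \<longleftrightarrow>
    subcrossed_module C S T sact \<sigma> A B act \<alpha> \<and>
    opideal C T B \<and>
    (\<forall>b\<in>carrier B. \<forall>s\<in>carrier S. dot act b s \<in> carrier S) \<and>
    (\<forall>t\<in>carrier T. \<forall>a\<in>carrier A. gadd A (dot act t a) (gneg A a) \<in> carrier S) \<and>
    (\<forall>w\<in>binops C. \<forall>b\<in>carrier B. \<forall>s\<in>carrier S. star act w b s \<in> carrier S) \<and>
    (\<forall>w\<in>binops C. \<forall>t\<in>carrier T. \<forall>a\<in>carrier A. star act w t a \<in> carrier S)"


section \<open>Internal groupoids\<close>

text \<open>
  \<open>gcomp G g f\<close> is meaningful only for composable pairs, i.e. when \<open>src G g = tgt G f\<close>.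
\<close>

record ('o, 'm, 'u, 'w) igroupoid =
  Obj :: "('o, 'u, 'w) opalg"
  Mor :: "('m, 'u, 'w) opalg"
  src :: "'m \<Rightarrow> 'o"
  tgt :: "'m \<Rightarrow> 'o"
  idn :: "'o \<Rightarrow> 'm"
  gcomp :: "'m \<Rightarrow> 'm \<Rightarrow> 'm"

definition composable :: "('o, 'm, 'u, 'w) igroupoid \<Rightarrow> 'm \<Rightarrow> 'm \<Rightarrow> bool" where
  "composable G g f \<longleftrightarrow>
    g \<in> carrier (Mor G) \<and> f \<in> carrier (Mor G) \<and> src G g = tgt G f"

definition internal_groupoid :: "('u, 'w) opcat \<Rightarrow> ('o, 'm, 'u, 'w) igroupoid \<Rightarrow> bool" where
  "internal_groupoid C G \<longleftrightarrow>
    opobject C (Obj G) \<and> opobject C (Mor G) \<and>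
    opmorphism C (Mor G) (Obj G) (src G) \<and>
    opmorphism C (Mor G) (Obj G) (tgt G) \<and>
    opmorphism C (Obj G) (Mor G) (idn G) \<and>
    (\<forall>x\<in>carrier (Obj G). src G (idn G x) = x \<and> tgt G (idn G x) = x) \<and>
    (\<forall>g f. composable G g f \<longrightarrow>
      gcomp G g f \<in> carrier (Mor G) \<and>
      src G (gcomp G g f) = src G f \<and> tgt G (gcomp G g f) = tgt G g) \<and>
    (\<forall>f\<in>carrier (Mor G).
      gcomp G f (idn G (src G f)) = f \<and> gcomp G (idn G (tgt G f)) f = f) \<and>
    (\<forall>h g f. composable G h g \<longrightarrow> composable G g f \<longrightarrow>
      gcomp G h (gcomp G g f) = gcomp G (gcomp G h g) f) \<and>
    (\<forall>f\<in>carrier (Mor G). \<exists>g. composable G g f \<and> composable G f g \<and>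
      gcomp G g f = idn G (src G f) \<and> gcomp G f g = idn G (tgt G f)) \<and>
    (\<forall>g f g' f'. composable G g f \<longrightarrow> composable G g' f' \<longrightarrow>
      gcomp G (gadd (Mor G) g g') (gadd (Mor G) f f') = gadd (Mor G) (gcomp G g f) (gcomp G g' f')) \<and>
    (\<forall>\<omega>\<in>unops C. \<forall>g f. composable G g f \<longrightarrow>
      gcomp G (unop (Mor G) \<omega> g) (unop (Mor G) \<omega> f) = unop (Mor G) \<omega> (gcomp G g f)) \<and>
    (\<forall>w\<in>binops C. \<forall>g f g' f'. composable G g f \<longrightarrow> composable G g' f' \<longrightarrow>
      gcomp G (binop (Mor G) w g g') (binop (Mor G) w f f') =
      binop (Mor G) w (gcomp G g f) (gcomp G g' f'))"

definition groupoid_of ::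
    "('u, 'w) opcat \<Rightarrow> ('a, 'u, 'w) opalg \<Rightarrow> ('b, 'u, 'w) opalg \<Rightarrow> ('a, 'b, 'w) opaction \<Rightarrow>
     ('a \<Rightarrow> 'b) \<Rightarrow> ('b, 'a \<times> 'b, 'u, 'w) igroupoid" where
  "groupoid_of C A B act \<alpha> =
    \<lparr>Obj = B,
     Mor = semidirect C A B act,
     src = (\<lambda>(a, b). b),
     tgt = (\<lambda>(a, b). gadd B (\<alpha> a) b),
     idn = (\<lambda>b. (gzero A, b)),
     gcomp = (\<lambda>(a', b') (a, b). (gadd A a' a, b))\<rparr>"

lemma internal_groupoid_groupoid_of:
  fixes A :: "('a, 'u, 'w) opalg" and B :: "('b, 'u, 'w) opalg"
  assumes gwo: "groups_with_operations C" and cm: "crossed_module C A B act \<alpha>"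
  shows "internal_groupoid C (groupoid_of C A B act \<alpha>)"
proof -
  have "derived_action C B A act"
    using cm by (simp add: crossed_module_def)
  then obtain E :: "('a \<times> 'b, 'u, 'w) opalg" and i p s where "split_ext C A E B i p s act"
    by (rule derived_action_split_ext[OF gwo])
  then interpret split_ext C A E B i p s act .
  interpret \<alpha>: op_morphism C A B \<alpha>
    using cm by unfold_locales (simp add: crossed_module_def)
  have \<alpha>_dot [simp]: "\<alpha> (dot act b a) = gadd B (gadd B b (\<alpha> a)) (gneg B b)"
    if "b \<in> carrier B" "a \<in> carrier A" for a b
    using cm that by (simp add: crossed_module_def)
  have dot_\<alpha> [simp]: "dot act (\<alpha> a) a' = gadd A (gadd A a a') (gneg A a)"
    if "a \<in> carrier A" "a' \<in> carrier A" for a a'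
    using cm that by (simp add: crossed_module_def)
  have star_\<alpha> [simp]: "star act w (\<alpha> a) a' = binop A w a a'"
    if "w \<in> binops C" "a \<in> carrier A" "a' \<in> carrier A" for w a a'
    using cm that by (simp add: crossed_module_def)
  have \<alpha>_star [simp]: "\<alpha> (star act w b a) = binop B w b (\<alpha> a)"
    "\<alpha> (star act (opp C w) b a) = binop B w (\<alpha> a) b"
    if "w \<in> binops C" "b \<in> carrier B" "a \<in> carrier A" for w a b
    using cm that by (simp_all add: crossed_module_def p.B.binop_opp)
  have dot_add_left: "dot act (gadd B b b') a = dot act b (dot act b' a)"
    if "b \<in> carrier B" "b' \<in> carrier B" "a \<in> carrier A" for b b' a
    by (rule inj_onD[OF inj_i]) (use that in simp_all)
  have dot_add_right: "dot act b (gadd A a a') = gadd A (dot act b a) (dot act b a')"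
    if "b \<in> carrier B" "a \<in> carrier A" "a' \<in> carrier A" for b a a'
    by (rule inj_onD[OF inj_i]) (use that in simp_all)
  have star_add_left: "star act w (gadd B b b') a = gadd A (star act w b a) (star act w b' a)"
    if "w \<in> binops C" "b \<in> carrier B" "b' \<in> carrier B" "a \<in> carrier A" for w b b' a
    by (rule inj_onD[OF inj_i]) (use that in \<open>simp_all add: i.B.binop_add_left\<close>)
  have star_add_right: "star act w b (gadd A a a') = gadd A (star act w b a) (star act w b a')"
    if "w \<in> binops C" "b \<in> carrier B" "a \<in> carrier A" "a' \<in> carrier A" for w b a a'
    by (rule inj_onD[OF inj_i]) (use that in \<open>simp_all add: i.B.binop_add_right\<close>)
  have star_opp: "star act (opp C w) (\<alpha> a) a' = binop A w a' a"
    if "w \<in> binops C" "a \<in> carrier A" "a' \<in> carrier A" for w a a'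
    using that by (simp add: i.A.binop_opp)
  let ?G = "groupoid_of C A B act \<alpha>"
  have tgt: "opmorphism C P B (\<lambda>(a, b). gadd B (\<alpha> a) b)"
    unfolding opmorphism_def
  proof (intro conjI ballI)
    show "(\<lambda>(a, b). gadd B (\<alpha> a) b) \<in> hom (add_group P) (add_group B)"
      by (auto simp: hom_def add_group_def)
  next
    fix \<omega> x assume "\<omega> \<in> unops C" "x \<in> carrier P"
    then show "(\<lambda>(a, b). gadd B (\<alpha> a) b) (unop P \<omega> x) = unop B \<omega> ((\<lambda>(a, b). gadd B (\<alpha> a) b) x)"
      by (auto simp: p.B.unop_add)
  next
    fix w x y assume w: "w \<in> binops C" and xy: "x \<in> carrier P" "y \<in> carrier P"
    then show "(\<lambda>(a, b). gadd B (\<alpha> a) b) (binop P w x y) =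
      binop B w ((\<lambda>(a, b). gadd B (\<alpha> a) b) x) ((\<lambda>(a, b). gadd B (\<alpha> a) b) y)"
      by (auto simp: p.B.binop_add_left p.B.binop_add_right p.B.binop_opp p.B.binop_AC)
  qed
  have src: "opmorphism C P B (\<lambda>(a, b). b)"
    using split_semidirect by (simp add: split_extension_def snd_def[abs_def])
  have idn: "opmorphism C B P (\<lambda>b. (gzero A, b))"
    using split_semidirect by (simp add: split_extension_def)
  have compos: "composable ?G g f \<longleftrightarrow> (\<exists>a a' b. a \<in> carrier A \<and> a' \<in> carrier A \<and> b \<in> carrier B \<and>
      f = (a, b) \<and> g = (a', gadd B (\<alpha> a) b))" for g f
    by (auto simp: composable_def groupoid_of_def)
  show ?thesis
    unfolding internal_groupoid_def
  proof (intro conjI ballI)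
    show "\<forall>h g f. composable ?G h g \<longrightarrow> composable ?G g f \<longrightarrow>
      gcomp ?G h (gcomp ?G g f) = gcomp ?G (gcomp ?G h g) f"
      by (auto simp: compos) (auto simp: groupoid_of_def)
  next
    show "\<forall>g f. composable ?G g f \<longrightarrow>
      gcomp ?G g f \<in> carrier (Mor ?G) \<and>
      src ?G (gcomp ?G g f) = src ?G f \<and> tgt ?G (gcomp ?G g f) = tgt ?G g"
      by (auto simp: compos) (auto simp: groupoid_of_def)
  next
    fix f assume f: "f \<in> carrier (Mor ?G)"
    then show "gcomp ?G f (idn ?G (src ?G f)) = f" "gcomp ?G (idn ?G (tgt ?G f)) f = f"
      by (auto simp: groupoid_of_def)
    obtain a b where ab: "f = (a, b)" "a \<in> carrier A" "b \<in> carrier B"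
      using f by (auto simp: groupoid_of_def)
    show "\<exists>g. composable ?G g f \<and> composable ?G f g \<and>
      gcomp ?G g f = idn ?G (src ?G f) \<and> gcomp ?G f g = idn ?G (tgt ?G f)"
      by (rule exI[of _ "(gneg A a, gadd B (\<alpha> a) b)"])
        (use ab in \<open>auto simp: composable_def groupoid_of_def\<close>)
  next
    show "\<forall>g f g' f'. composable ?G g f \<longrightarrow> composable ?G g' f' \<longrightarrow>
      gcomp ?G (gadd (Mor ?G) g g') (gadd (Mor ?G) f f') =
      gadd (Mor ?G) (gcomp ?G g f) (gcomp ?G g' f')"
      by (auto simp: compos) (auto simp: groupoid_of_def dot_add_left dot_add_right)
  next
    fix \<omega> assume "\<omega> \<in> unops C"
    then show "\<forall>g f. composable ?G g f \<longrightarrow>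
      gcomp ?G (unop (Mor ?G) \<omega> g) (unop (Mor ?G) \<omega> f) = unop (Mor ?G) \<omega> (gcomp ?G g f)"
      by (auto simp: compos) (auto simp: groupoid_of_def i.A.unop_add)
  next
    fix w assume w: "w \<in> binops C"
    show "\<forall>g f g' f'. composable ?G g f \<longrightarrow> composable ?G g' f' \<longrightarrow>
      gcomp ?G (binop (Mor ?G) w g g') (binop (Mor ?G) w f f') =
      binop (Mor ?G) w (gcomp ?G g f) (gcomp ?G g' f')"
    proof (clarsimp simp: compos)
      fix a c b a' c' b'
      assume c: "a \<in> carrier A" "c \<in> carrier A" "b \<in> carrier B"
        "a' \<in> carrier A" "c' \<in> carrier A" "b' \<in> carrier B"
      show "gcomp ?G (binop (Mor ?G) w (c, gadd B (\<alpha> a) b) (c', gadd B (\<alpha> a') b'))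
          (binop (Mor ?G) w (a, b) (a', b')) =
        binop (Mor ?G) w (gcomp ?G (c, gadd B (\<alpha> a) b) (a, b))
          (gcomp ?G (c', gadd B (\<alpha> a') b') (a', b'))"
        using w c
        by (auto simp: groupoid_of_def star_add_left star_add_right star_opp
            i.A.binop_add_left i.A.binop_add_right intro!: inj_onD[OF inj_i])
          (simp_all add: i.B.binop_opp i.B.binop_AC)
    qed
  qed (use src tgt idn opobject_semidirect p.B.obj in \<open>auto simp: groupoid_of_def\<close>)
qed

end

theory Submission
  imports Defs
begin

text \<open>
  The objects of \<open>N\<close> and \<open>G\<close> are \<open>T\<close> and \<open>B\<close>, so the second half is part of the normality
  hypothesis. The content is that \<open>S \<rtimes> T\<close> is an ideal of \<open>A \<rtimes> B\<close>.

  Because the action of \<open>B\<close> on \<open>A\<close> preserves \<open>S\<close>, and \<open>A\<close> itself acts on \<open>S\<close> through \<open>\<alpha>\<close> by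
  conjugation and multiplication, \<open>S\<close> absorbs conjugation by \<open>A\<close> and products with elements of
  \<open>A\<close> (\<open>crossed_module_invariant_absorbs\<close>). The first component of \<open>(a, b) \<star> (s, t)\<close> has the
  summands \<open>a \<star> s\<close>, \<open>a \<star> t\<close> and \<open>b \<star> s\<close>. The outer two are in \<open>S\<close> because \<open>S\<close> is invariant
  under \<open>B\<close>, and the middle one is \<open>t \<star>\<degree> a\<close>, which is in \<open>S\<close> by the condition on the action of
  \<open>T\<close> on \<open>A\<close>. For additive normality, put \<open>t' = b + t - b\<close>, which is in \<open>T\<close>. Then

    \<open>(a, b) + (s, t) - (a, b) = (a + b \<cdot> s + t' \<cdot> (-a), t')\<close>

  (\<open>semidirect_conjugation\<close>), and the first component is \<open>a + v - a\<close> with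
  \<open>v = b \<cdot> s + (t' \<cdot> (-a) - (-a))\<close>. Both summands of \<open>v\<close> are in \<open>S\<close> by normality, hence so is
  the conjugate \<open>a + v - a\<close>.
\<close>

lemma (in op_object) inv_add_group:
  assumes "x \<in> carrier A"
  shows "inv\<^bsub>add_group A\<^esub> x = gneg A x"
  using assms
  by (intro group.inv_equality[OF group_add_group]) (simp_all add: add_group_def)

lemma (in op_object) subobject_subgroup:
  assumes "subobject C N A"
  shows "subgroup (carrier N) (add_group A)"
proof (rule group.subgroupI[OF group_add_group])
  show "carrier N \<noteq> {}"
    using assms by (auto simp: subobject_def closed_under_ops_def)
next
  fix x assume "x \<in> carrier N"
  with assms show "inv\<^bsub>add_group A\<^esub> x \<in> carrier N"
    by (subst inv_add_group) (auto simp: subobject_def closed_under_ops_def)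
qed (use assms in \<open>auto simp: subobject_def closed_under_ops_def add_group_def\<close>)

lemma (in op_object) opideal_iff_conjugation:
  "opideal C N A \<longleftrightarrow>
    subobject C N A \<and>
    (\<forall>a\<in>carrier A. \<forall>n\<in>carrier N. gadd A (gadd A a n) (gneg A a) \<in> carrier N) \<and>
    (\<forall>w\<in>binops C. \<forall>a\<in>carrier A. \<forall>n\<in>carrier N. binop A w a n \<in> carrier N)"
proof (cases "subobject C N A")
  case True
  have "carrier N \<lhd> add_group A \<longleftrightarrow>
    (\<forall>a\<in>carrier A. \<forall>n\<in>carrier N. gadd A (gadd A a n) (gneg A a) \<in> carrier N)"
    unfolding group.normal_inv_iff[OF group_add_group]
    using subobject_subgroup[OF True] inv_add_group by (simp add: add_group_def)
  with True show ?thesis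
    by (simp add: opideal_def)
qed (simp add: opideal_def)

lemma (in split_ext) dot_add_left:
  assumes "b \<in> carrier B" "b' \<in> carrier B" "a \<in> carrier A"
  shows "dot act (gadd B b b') a = dot act b (dot act b' a)"
  by (rule inj_onD[OF inj_i]) (use assms in simp_all)

lemma (in split_ext) semidirect_conjugation:
  assumes "a \<in> carrier A" "b \<in> carrier B" "c \<in> carrier A" "d \<in> carrier B"
  shows "gadd P (gadd P (a, b) (c, d)) (gneg P (a, b)) =
    (gadd A (gadd A a (dot act b c)) (dot act (gadd B (gadd B b d) (gneg B b)) (gneg A a)),
     gadd B (gadd B b d) (gneg B b))"
  using assms by (simp add: dot_add_left)

text \<open>
  The operations of a semidirect product are built from those of its factors and from the action,
  so they restrict as soon as these do.
\<close>

lemma subobject_semidirect: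
  assumes P: "opobject C (semidirect C A B act)"
    and opp: "\<And>w. w \<in> binops C \<Longrightarrow> opp C w \<in> binops C"
    and S: "subobject C S A" and T: "subobject C T B"
    and dot: "\<And>t s. t \<in> carrier T \<Longrightarrow> s \<in> carrier S \<Longrightarrow>
      dot act t s \<in> carrier S \<and> dot sact t s = dot act t s"
    and star: "\<And>w t s. w \<in> binops C \<Longrightarrow> t \<in> carrier T \<Longrightarrow> s \<in> carrier S \<Longrightarrow>
      star act w t s \<in> carrier S \<and> star sact w t s = star act w t s"
  shows "subobject C (semidirect C S T sact) (semidirect C A B act)"
  using assms by (auto simp: subobject_def closed_under_ops_def)

text \<open>
  By the Peiffer identities the action of \<open>\<alpha> a\<close> on \<open>A\<close> is conjugation by, respectively
  multiplication with, \<open>a\<close>; so invariance under \<open>B\<close> includes absorption by \<open>A\<close>.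
\<close>

lemma crossed_module_invariant_absorbs:
  assumes "crossed_module C A B act \<alpha>"
    and "S \<subseteq> carrier A"
    and "\<And>b s. b \<in> carrier B \<Longrightarrow> s \<in> S \<Longrightarrow> dot act b s \<in> S"
    and "\<And>w b s. w \<in> binops C \<Longrightarrow> b \<in> carrier B \<Longrightarrow> s \<in> S \<Longrightarrow> star act w b s \<in> S"
    and "a \<in> carrier A" "s \<in> S"
  shows "gadd A (gadd A a s) (gneg A a) \<in> S"
    and "w \<in> binops C \<Longrightarrow> binop A w a s \<in> S"
proof -
  have \<alpha>a: "\<alpha> a \<in> carrier B"
    using assms(1,5) by (auto simp: crossed_module_def opmorphism_def hom_def add_group_def)
  have s: "s \<in> carrier A"
    using assms(2,6) by blast
  have "gadd A (gadd A a s) (gneg A a) = dot act (\<alpha> a) s"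
    using assms(1,5) s by (simp add: crossed_module_def)
  with assms(3)[OF \<alpha>a assms(6)] show "gadd A (gadd A a s) (gneg A a) \<in> S"
    by simp
  show "binop A w a s \<in> S" if w: "w \<in> binops C"
  proof -
    have "binop A w a s = star act w (\<alpha> a) s"
      using assms(1,5) s w by (simp add: crossed_module_def)
    with assms(4)[OF w \<alpha>a assms(6)] show ?thesis
      by simp
  qed
qed

lemma opideal_semidirect:
  fixes A S :: "('a, 'u, 'w) opalg" and B T :: "('b, 'u, 'w) opalg"
  assumes gwo: "groups_with_operations C"
    and normal: "normal_subcrossed_module C S T sact \<sigma> A B act \<alpha>"
  shows "opideal C (semidirect C S T sact) (semidirect C A B act)"
proof -
  have cm: "crossed_module C A B act \<alpha>" and S: "subobject C S A" and T: "opideal C T B"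
    and restrict: "\<And>t s. t \<in> carrier T \<Longrightarrow> s \<in> carrier S \<Longrightarrow> dot sact t s = dot act t s"
      "\<And>w t s. w \<in> binops C \<Longrightarrow> t \<in> carrier T \<Longrightarrow> s \<in> carrier S \<Longrightarrow>
        star sact w t s = star act w t s"
    and dotS: "\<And>b s. b \<in> carrier B \<Longrightarrow> s \<in> carrier S \<Longrightarrow> dot act b s \<in> carrier S"
    and dotT: "\<And>t a. t \<in> carrier T \<Longrightarrow> a \<in> carrier A \<Longrightarrow>
        gadd A (dot act t a) (gneg A a) \<in> carrier S"
    and starS: "\<And>w b s. w \<in> binops C \<Longrightarrow> b \<in> carrier B \<Longrightarrow> s \<in> carrier S \<Longrightarrow>
        star act w b s \<in> carrier S"
    and starT: "\<And>w t a. w \<in> binops C \<Longrightarrow> t \<in> carrier T \<Longrightarrow> a \<in> carrier A \<Longrightarrow>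
        star act w t a \<in> carrier S"
    using normal by (auto simp: normal_subcrossed_module_def subcrossed_module_def)
  have "derived_action C B A act"
    using cm by (simp add: crossed_module_def)
  then obtain E :: "('a \<times> 'b, 'u, 'w) opalg" and i p s where "split_ext C A E B i p s act"
    by (rule derived_action_split_ext[OF gwo])
  then interpret split_ext C A E B i p s act .
  interpret P: op_object C P
    using gwo opobject_semidirect by unfold_locales
  have SA: "carrier S \<subseteq> carrier A"
    and S_add: "\<And>x y. x \<in> carrier S \<Longrightarrow> y \<in> carrier S \<Longrightarrow> gadd A x y \<in> carrier S"
    using S by (auto simp: subobject_def closed_under_ops_def)
  have subT: "subobject C T B"
    and T_conj: "\<And>b t. b \<in> carrier B \<Longrightarrow> t \<in> carrier T \<Longrightarrow>
        gadd B (gadd B b t) (gneg B b) \<in> carrier T"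
    and T_binop: "\<And>w b t. w \<in> binops C \<Longrightarrow> b \<in> carrier B \<Longrightarrow> t \<in> carrier T \<Longrightarrow>
        binop B w b t \<in> carrier T"
    using T by (simp_all add: p.B.opideal_iff_conjugation)
  have TB: "carrier T \<subseteq> carrier B"
    using subT by (simp add: subobject_def)
  note absorbs = crossed_module_invariant_absorbs[OF cm SA dotS starS]
  have "subobject C (semidirect C S T sact) P"
    using opobject_semidirect i.A.opp_closed S subT
    by (rule subobject_semidirect) (use TB dotS starS restrict in auto)
  moreover have "gadd P (gadd P x y) (gneg P x) \<in> carrier (semidirect C S T sact)"
    if xy: "x \<in> carrier P" "y \<in> carrier (semidirect C S T sact)" for x y
  proof -
    obtain a b u t where x: "x = (a, b)" "a \<in> carrier A" "b \<in> carrier B"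
      and y: "y = (u, t)" "u \<in> carrier S" "t \<in> carrier T"
      using xy by auto
    define t' where "t' = gadd B (gadd B b t) (gneg B b)"
    \<comment> \<open>Conjugating \<open>v\<close> by \<open>a\<close> cancels the final \<open>- (- a)\<close>, which is there to turn
      \<open>t' \<cdot> (- a)\<close> into one of the differences that normality places in \<open>S\<close>.\<close>
    define v where "v = gadd A (dot act b u) (gadd A (dot act t' (gneg A a)) (gneg A (gneg A a)))"
    have t': "t' \<in> carrier T"
      using T_conj x y by (simp add: t'_def)
    have v: "v \<in> carrier S"
      unfolding v_def using x y t' by (intro S_add dotS dotT) simp_all
    have "gadd A (gadd A a (dot act b u)) (dot act t' (gneg A a)) =
        gadd A (gadd A a v) (gneg A a)"
      using x y t' SA TB by (auto simp: v_def subset_iff)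
    moreover have "gadd A (gadd A a v) (gneg A a) \<in> carrier S"
      using absorbs(1) x v by simp
    moreover have "gadd P (gadd P x y) (gneg P x) =
        (gadd A (gadd A a (dot act b u)) (dot act t' (gneg A a)), t')"
      unfolding t'_def x(1) y(1) by (rule semidirect_conjugation) (use x y SA TB in auto)
    ultimately show ?thesis
      using t' by simp
  qed
  moreover have "binop P w x y \<in> carrier (semidirect C S T sact)"
    if w: "w \<in> binops C" and xy: "x \<in> carrier P" "y \<in> carrier (semidirect C S T sact)" for w x y
  proof -
    obtain a b u t where x: "x = (a, b)" "a \<in> carrier A" "b \<in> carrier B"
      and y: "y = (u, t)" "u \<in> carrier S" "t \<in> carrier T"
      using xy by auto
    show ?thesis
      using w x y absorbs(2)[of a u w] by (simp add: S_add starS starT T_binop)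
  qed
  ultimately show ?thesis
    unfolding P.opideal_iff_conjugation by blast
qed

theorem theorem5p11:
  fixes C :: "('u, 'w) opcat"
    and A S :: "('a, 'u, 'w) opalg" and B T :: "('b, 'u, 'w) opalg"
    and act sact :: "('a, 'b, 'w) opaction" and \<alpha> \<sigma> :: "'a \<Rightarrow> 'b"
    and N G :: "('b, 'a \<times> 'b, 'u, 'w) igroupoid"
  assumes "groups_with_operations C"
    and "crossed_module C A B act \<alpha>"
    and "normal_subcrossed_module C S T sact \<sigma> A B act \<alpha>"
    and "N = groupoid_of C S T sact \<sigma>"
    and "G = groupoid_of C A B act \<alpha>"
  shows "opideal C (Mor N) (Mor G) \<and> opideal C (Obj N) (Obj G)"
proof
  show "opideal C (Mor N) (Mor G)"
    using opideal_semidirect[OF assms(1,3)] assms(4,5) by (simp add: groupoid_of_def)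
  show "opideal C (Obj N) (Obj G)"
    using assms(3-5) by (simp add: groupoid_of_def normal_subcrossed_module_def)
qed

end
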